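(* Let $n\ge2$ and $m\ge2$. For any probability vector $\omega=(w_1,\ldots,w_m)$ with at least two positive weights, there exists no constant $c>0$ for which the sequence $\{X_k\}$ from the projection mean iteration $$\log(X_k^{-1}X_{k+1})=\frac1c\sum_{i=1}^m w_i\log(X_k^{-1}A_i),\qquad k\ge0,$$ converges for every choice of $A_1,\ldots,A_m\in\mathrm{UT}_n$.
   Context: $\mathrm{UT}_n$ is the group of $n\times n$ real upper triangular matrices with positive diagonal entries. A probability vector has nonnegative entries summing to $1$. For $A\in\mathrm{UT}_n$, $\log A$ is the principal logarithm (the unique real upper triangular matrix $L$ with $\exp L=A$). The projection mean iteration starts from an initial point $X_0\in\mathrm{UT}_n$ and is equivalently $X_{k+1}=X_k\exp\left(\frac1c\sum_{i=1}^m w_i\log(X_k^{-1}A_i)\right)$ for $k\ge0$, where $c>0$ is a relaxation denominator (the step size is $1/c$). *)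

theory Defs
  imports "HOL-Analysis.Analysis"
begin

text \<open>Square matrices of size \<open>n\<close> are indexed by a finite linearly ordered type \<open>'n\<close> with
  \<open>CARD('n) = n\<close>; every such type is order isomorphic to \<open>{1..n}\<close>.\<close>

definition upper_triangular :: "real ^ 'n::{finite,linorder} ^ 'n::_ \<Rightarrow> bool" where
  "upper_triangular A \<longleftrightarrow> (\<forall>i j. j < i \<longrightarrow> A $ i $ j = 0)"

definition UT :: "(real ^ 'n::{finite,linorder} ^ 'n::_) set" where
  "UT = {A. upper_triangular A \<and> (\<forall>i. A $ i $ i > 0)}"

text \<open>The ring operations \<open>*\<close> and \<open>^\<close> that the library puts on \<open>real ^ 'n ^ 'n\<close> are
  componentwise, so neither \<open>exp\<close> nor \<open>^\<close> is available for the matrix product \<open>**\<close>.\<close>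

definition mat_power :: "real ^ 'n ^ 'n \<Rightarrow> nat \<Rightarrow> real ^ 'n ^ 'n" where
  "mat_power A k = (((**) A) ^^ k) (mat 1)"

definition mat_exp :: "real ^ 'n ^ 'n \<Rightarrow> real ^ 'n ^ 'n" where
  "mat_exp A = (\<Sum>k. (1 / fact k) *\<^sub>R mat_power A k)"

text \<open>The principal logarithm; meaningful for arguments in \<open>UT\<close>.\<close>

definition ut_log :: "real ^ 'n::{finite,linorder} ^ 'n::_ \<Rightarrow> real ^ 'n::_ ^ 'n::_" where
  "ut_log A = (THE L. upper_triangular L \<and> mat_exp L = A)"

text \<open>Weights and data are indexed by \<open>{1..m}\<close>; their values at other indices are irrelevant.\<close>

definition probability_vector :: "nat \<Rightarrow> (nat \<Rightarrow> real) \<Rightarrow> bool" where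
  "probability_vector m w \<longleftrightarrow> (\<forall>i\<in>{1..m}. w i \<ge> 0) \<and> (\<Sum>i=1..m. w i) = 1"

text \<open>Since \<open>ut_log\<close> is injective on \<open>UT\<close> with range the upper triangular matrices, for
  \<open>X\<^sub>0 \<in> UT\<close> and data in \<open>UT\<close> exactly one sequence satisfies this predicate.\<close>

definition projection_mean_iteration ::
  "nat \<Rightarrow> (nat \<Rightarrow> real) \<Rightarrow> real \<Rightarrow> (nat \<Rightarrow> real ^ 'n::{finite,linorder} ^ 'n::_) \<Rightarrow>
    real ^ 'n::_ ^ 'n::_ \<Rightarrow> (nat \<Rightarrow> real ^ 'n::_ ^ 'n::_) \<Rightarrow> bool" where
  "projection_mean_iteration m w c A X\<^sub>0 X \<longleftrightarrow>
     X 0 = X\<^sub>0 \<and> (\<forall>k. X k \<in> UT) \<and>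
     (\<forall>k. ut_log (matrix_inv (X k) ** X (Suc k)) =
          (1 / c) *\<^sub>R (\<Sum>i=1..m. w i *\<^sub>R ut_log (matrix_inv (X k) ** A i)))"

end

theory Submission
  imports Defs
begin

text \<open>Everything takes place in a copy of the affine group of the line: for indices \<open>a < b\<close>, the matrices
  \<open>mat 1 + aff a b s v\<close> differ from the identity only in the entries \<open>(a, a)\<close> and \<open>(a, b)\<close>.
  After left translation by \<open>X\<^sub>0\<close>, take data with \<open>(a, a)\<close> entries \<open>exp (u i)\<close>
  where the weighted mean of the \<open>u i\<close> is zero. Then the iterates keep unit diagonal, and their
  \<open>(a, b)\<close> entry follows an affine recurrence with multiplier
  \<open>1 - (1 / c) * (\<Sum>i. w i * u i / (exp (u i) - 1))\<close>. Since \<open>u / (exp u - 1)\<close> is positive and unbounded as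
  \<open>u\<close> tends to \<open>-\<infinity>\<close>, two positive weights suffice to make the multiplier at most \<open>-1\<close> for any given
  \<open>c\<close>, and the recurrence then converges only when started at its fixed
  point.\<close>

section \<open>Entrywise convergence of the matrix exponential\<close>

lemma mat_power_0 [simp]: "mat_power A 0 = mat 1"
  by (simp add: mat_power_def)

lemma mat_power_Suc [simp]: "mat_power A (Suc k) = A ** mat_power A k"
  by (simp add: mat_power_def)

lemma matrix_mult_component: "(A ** B) $ i $ j = (\<Sum>k\<in>UNIV. A $ i $ k * B $ k $ j)"
  by (simp add: matrix_matrix_mult_def)

text \<open>This crude geometric bound gives the exponential series of a scalar as a majorant for
  every entry of the matrix series.\<close>

lemma abs_mat_power_component_le:
  fixes A :: "real ^ 'n ^ 'n"
  assumes A: "\<And>i j. \<bar>A $ i $ j\<bar> \<le> C"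
  shows "\<bar>mat_power A k $ i $ j\<bar> \<le> (real CARD('n) * C) ^ k"
proof (induction k arbitrary: i)
  case 0
  show ?case by (simp add: mat_def)
next
  case (Suc k)
  have C: "0 \<le> C"
    using A[of i i] by linarith
  have "\<bar>mat_power A (Suc k) $ i $ j\<bar> \<le> (\<Sum>l\<in>UNIV. \<bar>A $ i $ l * mat_power A k $ l $ j\<bar>)"
    by (simp add: matrix_mult_component)
  also have "\<dots> \<le> (\<Sum>l\<in>(UNIV::'n set). C * (real CARD('n) * C) ^ k)"
    unfolding abs_mult by (intro sum_mono mult_mono A Suc.IH C) simp
  also have "\<dots> = (real CARD('n) * C) ^ Suc k"
    by simp
  finally show ?case .
qed

lemma mat_exp_component_sums:
  fixes A :: "real ^ 'n ^ 'n"
  shows "(\<lambda>k. mat_power A k $ i $ j / fact k) sums (mat_exp A $ i $ j)"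
proof -
  obtain C where C: "\<And>i j. \<bar>A $ i $ j\<bar> \<le> C"
  proof
    fix i j
    have "\<bar>A $ i $ j\<bar> \<le> norm (A $ i)"
      by (rule component_le_norm_cart)
    also have "\<dots> \<le> norm A"
      by (rule Finite_Cartesian_Product.norm_nth_le)
    finally show "\<bar>A $ i $ j\<bar> \<le> norm A" .
  qed
  have entry: "summable (\<lambda>k. mat_power A k $ i $ j / fact k)" for i j
  proof (rule summable_comparison_test')
    show "summable (\<lambda>k. (real CARD('n) * C) ^ k /\<^sub>R fact k)"
      by (rule summable_exp_generic)
    show "norm (mat_power A k $ i $ j / fact k) \<le> (real CARD('n) * C) ^ k /\<^sub>R fact k" for k
      using abs_mat_power_component_le[OF C] by (simp add: field_simps)
  qed
  define S where "S = (\<chi> i j. \<Sum>k. mat_power A k $ i $ j / fact k)"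
  have "(\<lambda>k. (1 / fact k) *\<^sub>R mat_power A k) sums S"
    unfolding sums_def
  proof (intro vec_tendstoI)
    fix i j
    show "(\<lambda>N. (\<Sum>k<N. (1 / fact k) *\<^sub>R mat_power A k) $ i $ j) \<longlonglongrightarrow> S $ i $ j"
      using summable_sums[OF entry[of i j]] by (simp add: sums_def S_def)
  qed
  then have "mat_exp A = S"
    by (simp add: mat_exp_def sums_iff)
  then show ?thesis
    using summable_sums[OF entry[of i j]] by (simp add: S_def)
qed

section \<open>Products, powers and invertibility of upper triangular matrices\<close>

lemma upper_triangular_mult:
  assumes "upper_triangular A" "upper_triangular B"
  shows "upper_triangular (A ** B)"
proof -
  have "A $ i $ k * B $ k $ j = 0" if "j < i" for i j k
    using assms that by (cases "k < i") (auto simp: upper_triangular_def)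
  then show ?thesis
    unfolding upper_triangular_def matrix_mult_component by (intro allI impI sum.neutral ballI)
qed

lemma upper_triangular_mult_diag:
  assumes "upper_triangular A" "upper_triangular B"
  shows "(A ** B) $ i $ i = A $ i $ i * B $ i $ i"
proof -
  have "(A ** B) $ i $ i = (\<Sum>k\<in>UNIV. if k = i then A $ i $ i * B $ i $ i else 0)"
    unfolding matrix_mult_component using assms
    by (intro sum.cong) (auto simp: upper_triangular_def neq_iff)
  then show ?thesis by simp
qed

lemma UT_mult: "A \<in> UT \<Longrightarrow> B \<in> UT \<Longrightarrow> A ** B \<in> UT"
  by (simp add: UT_def upper_triangular_mult upper_triangular_mult_diag)

lemma upper_triangular_mat_power:
  "upper_triangular A \<Longrightarrow> upper_triangular (mat_power A k)"
  by (induction k) (auto simp: upper_triangular_mult, simp add: upper_triangular_def mat_def)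

lemma mat_power_diag:
  "upper_triangular A \<Longrightarrow> mat_power A k $ i $ i = (A $ i $ i) ^ k"
  by (induction k)
    (simp_all add: upper_triangular_mult_diag upper_triangular_mat_power, simp add: mat_def)

lemma mat_exp_diag:
  assumes "upper_triangular A"
  shows "mat_exp A $ i $ i = exp (A $ i $ i)"
  using mat_exp_component_sums[of A i i] exp_converges[of "A $ i $ i"]
  by (simp add: mat_power_diag[OF assms] field_simps sums_unique2)

text \<open>Back substitution: the last nonzero coordinate of a kernel vector would be annihilated
  by a positive diagonal entry.\<close>

lemma invertible_UT:
  fixes A :: "real ^ 'n::{finite,linorder} ^ 'n::_"
  assumes "A \<in> UT"
  shows "invertible A"
proof -
  have "x = 0" if x: "A *v x = 0" for x
  proof (rule ccontr)
    assume "x \<noteq> 0"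
    then have ne: "{i. x $ i \<noteq> 0} \<noteq> {}"
      by (auto simp: vec_eq_iff)
    define i where "i = Max {i. x $ i \<noteq> 0}"
    have i: "x $ i \<noteq> 0"
      using Max_in[OF _ ne] by (simp add: i_def)
    have above: "x $ k = 0" if "i < k" for k
      using Max_ge[of "{i. x $ i \<noteq> 0}" k] that by (auto simp: i_def[symmetric] not_le[symmetric])
    have "(A *v x) $ i = (\<Sum>k\<in>UNIV. A $ i $ k * x $ k)"
      by (simp add: matrix_vector_mult_def)
    also have "\<dots> = (\<Sum>k\<in>UNIV. if k = i then A $ i $ i * x $ i else 0)"
      using assms above by (intro sum.cong) (auto simp: UT_def upper_triangular_def neq_iff)
    also have "\<dots> = A $ i $ i * x $ i"
      by simp
    finally show False
      using x i assms less_irrefl[of "0::real"] by (auto simp: UT_def dest: spec[of _ i])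
  qed
  then show ?thesis
    by (simp add: invertible_left_inverse matrix_left_invertible_ker)
qed

section \<open>Injectivity of the exponential on upper triangular matrices\<close>

text \<open>Expand the product \<open>L ** mat_power L k\<close> and its analogue for
  \<open>M\<close> at \<open>(i, j)\<close>. Triangularity kills the terms outside
  \<open>{i..j}\<close>, those strictly inside cancel, and only \<open>l = i\<close> and
  \<open>l = j\<close> survive. This yields a linear recurrence for the difference.\<close>

lemma mat_power_diff_component:
  fixes L M :: "real ^ 'n::{finite,linorder} ^ 'n::_"
  assumes L: "upper_triangular L" and M: "upper_triangular M" and ij: "i < j"
    and agree: "\<And>p q. p \<le> q \<Longrightarrow> i \<le> p \<Longrightarrow> q \<le> j \<Longrightarrow> (p, q) \<noteq> (i, j) \<Longrightarrow> L $ p $ q = M $ p $ q"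
  shows "mat_power L k $ i $ j - mat_power M k $ i $ j
    = (L $ i $ j - M $ i $ j) * (\<Sum>r<k. (L $ i $ i) ^ (k - Suc r) * (L $ j $ j) ^ r)"
proof -
  have zero: "L $ p $ q = 0" "M $ p $ q = 0" "mat_power L k $ p $ q = 0" "mat_power M k $ p $ q = 0"
    if "q < p" for p q k
    using L M upper_triangular_mat_power[OF L, of k] upper_triangular_mat_power[OF M, of k] that
    by (auto simp: upper_triangular_def)
  \<comment> \<open>Entry \<open>(p, q)\<close> of a power involves only entries with both indices
    between \<open>p\<close> and \<open>q\<close>, so the disputed entry \<open>(i, j)\<close>
    enters only when \<open>(p, q) = (i, j)\<close>.\<close>
  have same: "mat_power L k $ p $ q = mat_power M k $ p $ q"
    if "i \<le> p" "q \<le> j" "(p, q) \<noteq> (i, j)" for p q k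
    using that
  proof (induction k arbitrary: p)
    case (Suc k)
    have "L $ p $ l * mat_power L k $ l $ q = M $ p $ l * mat_power M k $ l $ q" for l
    proof (cases "p \<le> l \<and> l \<le> q")
      case True
      then have "i \<le> l" "l \<le> j" "(p, l) \<noteq> (i, j)"
        using Suc.prems order_trans[of l q j] order_trans[of i p l] by auto
      then have "L $ p $ l = M $ p $ l"
        using agree[of p l] True Suc.prems by simp
      moreover have "(l, q) \<noteq> (i, j)"
        using True Suc.prems by auto
      ultimately show ?thesis
        using Suc.IH[of l] \<open>i \<le> l\<close> Suc.prems by auto
    qed (auto simp: not_le zero)
    then show ?case
      by (simp add: matrix_mult_component)
  qed simp
  define d where "d = L $ i $ j - M $ i $ j"
  define e where "e = (\<lambda>k. mat_power L k $ i $ j - mat_power M k $ i $ j)"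
  have jj: "M $ j $ j = L $ j $ j"
    using agree[of j j] ij by auto
  have step: "e (Suc k) = L $ i $ i * e k + d * (L $ j $ j) ^ k" for k
  proof -
    have "e (Suc k) = (\<Sum>l\<in>UNIV. L $ i $ l * mat_power L k $ l $ j - M $ i $ l * mat_power M k $ l $ j)"
      by (simp add: e_def matrix_mult_component sum_subtractf)
    also have "\<dots> = (\<Sum>l\<in>UNIV. (if l = i then L $ i $ i * e k else 0)
        + (if l = j then d * (L $ j $ j) ^ k else 0))"
    proof (rule sum.cong)
      fix l
      consider "l < i" | "l = i" | "i < l" "l < j" | "l = j" | "j < l"
        by fastforce
      then show "L $ i $ l * mat_power L k $ l $ j - M $ i $ l * mat_power M k $ l $ j
        = (if l = i then L $ i $ i * e k else 0) + (if l = j then d * (L $ j $ j) ^ k else 0)"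
      proof cases
        case 2
        then show ?thesis
          using agree[of i i] ij by (simp add: e_def algebra_simps)
      next
        case 3
        then show ?thesis
          using agree[of i l] same[of l j] by (simp add: less_imp_neq[symmetric] less_imp_neq)
      next
        case 4
        then show ?thesis
          using ij jj by (simp add: d_def mat_power_diag L M algebra_simps)
      qed (use ij in \<open>auto simp: zero\<close>)
    qed simp
    also have "\<dots> = L $ i $ i * e k + d * (L $ j $ j) ^ k"
      by (simp add: sum.distrib)
    finally show ?thesis .
  qed
  have "e k = d * (\<Sum>r<k. (L $ i $ i) ^ (k - Suc r) * (L $ j $ j) ^ r)"
  proof (induction k)
    case 0
    show ?case by (simp add: e_def)
  next
    case (Suc k)
    have "(\<Sum>r<k. (L $ i $ i) ^ (k - r) * (L $ j $ j) ^ r)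
        = L $ i $ i * (\<Sum>r<k. (L $ i $ i) ^ (k - Suc r) * (L $ j $ j) ^ r)"
      unfolding sum_distrib_left
      by (intro sum.cong) (simp_all add: Suc_diff_Suc flip: mult.assoc power_Suc)
    then show ?case
      by (simp add: step Suc algebra_simps)
  qed
  then show ?thesis
    by (simp add: d_def e_def)
qed

text \<open>The sum is the divided difference of \<open>exp\<close> at \<open>x\<close> and \<open>y\<close>.\<close>

lemma exp_divided_difference_nonzero:
  fixes x y D :: real
  assumes "(\<lambda>k. (\<Sum>r<k. x ^ (k - Suc r) * y ^ r) / fact k) sums D"
  shows "D \<noteq> 0"
proof (cases "x = y")
  case True
  \<comment> \<open>The term for \<open>k = 0\<close> is an empty sum, so shifting the index leaves
    \<open>D\<close> unchanged.\<close>
  have "(\<lambda>k. (\<Sum>r<Suc k. x ^ (Suc k - Suc r) * y ^ r) / fact (Suc k)) sums D"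
    using assms by (subst sums_Suc_iff) simp
  moreover have "(\<Sum>r<Suc k. x ^ (Suc k - Suc r) * y ^ r) / fact (Suc k) = x ^ k /\<^sub>R fact k" for k
  proof -
    have "(\<Sum>r<Suc k. x ^ (Suc k - Suc r) * y ^ r) = (\<Sum>r<Suc k. x ^ k)"
      using True by (intro sum.cong) (auto simp flip: power_add)
    also have "\<dots> = real (Suc k) * x ^ k"
      by simp
    finally show ?thesis
      unfolding fact_Suc by (simp add: divide_inverse del: sum.lessThan_Suc of_nat_Suc)
  qed
  ultimately have "D = exp x"
    using exp_converges[of x] by (simp add: sums_unique2 del: sum.lessThan_Suc)
  then show ?thesis by simp
next
  case False
  \<comment> \<open>Here \<open>D = (exp x - exp y) / (x - y)\<close>, which is nonzero because
    \<open>exp\<close> is injective on the reals.\<close>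
  have "(\<lambda>k. x ^ k /\<^sub>R fact k - y ^ k /\<^sub>R fact k) sums (exp x - exp y)"
    by (intro sums_diff exp_converges)
  moreover have "x ^ k /\<^sub>R fact k - y ^ k /\<^sub>R fact k
      = (x - y) * ((\<Sum>r<k. x ^ (k - Suc r) * y ^ r) / fact k)" for k
    using power_diff_sumr2[of y k x] by (simp add: field_simps)
  ultimately have "(x - y) * D = exp x - exp y"
    using sums_mult[OF assms, of "x - y"] by (simp add: sums_unique2)
  then show ?thesis
    using False by auto
qed

text \<open>Once all other entries with indices between \<open>i\<close> and \<open>j\<close> are known, the
  \<open>(i, j)\<close> entry of \<open>mat_exp L\<close> is an affine function of \<open>L $ i $ j\<close> with nonzero slope.\<close>

lemma mat_exp_inj_on_upper_triangular:
  fixes L M :: "real ^ 'n::{finite,linorder} ^ 'n::_"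
  assumes L: "upper_triangular L" and M: "upper_triangular M" and eq: "mat_exp L = mat_exp M"
  shows "L = M"
proof -
  have "L $ i $ j = M $ i $ j" if "i \<le> j" for i j
    using that
  \<comment> \<open>The cardinality of \<open>{i..j}\<close> measures the distance from the
    diagonal, so the entries are determined one superdiagonal after another.\<close>
  proof (induction "card {i..j}" arbitrary: i j rule: less_induct)
    case less
    show ?case
    proof (cases "i = j")
      case True
      have "exp (L $ i $ i) = exp (M $ i $ i)"
        using mat_exp_diag[OF L, of i] mat_exp_diag[OF M, of i] eq by simp
      then show ?thesis
        using True by simp
    next
      case False
      with less.prems have ij: "i < j" by simp
      have agree: "L $ p $ q = M $ p $ q"
        if "p \<le> q" "i \<le> p" "q \<le> j" "(p, q) \<noteq> (i, j)" for p q
      proof -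
        have "{p..q} \<subset> {i..j}"
          using that ij by auto
        then show ?thesis
          using less.hyps[of p q] that psubset_card_mono[of "{i..j}"] by simp
      qed
      define d where "d = L $ i $ j - M $ i $ j"
      define S where "S = (\<lambda>k. (\<Sum>r<k. (L $ i $ i) ^ (k - Suc r) * (L $ j $ j) ^ r))"
      have "(\<lambda>k. mat_power L k $ i $ j / fact k - mat_power M k $ i $ j / fact k) sums 0"
        using sums_diff[OF mat_exp_component_sums[of L i j] mat_exp_component_sums[of M i j]] eq
        by simp
      then have "(\<lambda>k. (mat_power L k $ i $ j - mat_power M k $ i $ j) / fact k) sums 0"
        by (simp add: diff_divide_distrib)
      moreover have "mat_power L k $ i $ j - mat_power M k $ i $ j = d * S k" for k
        unfolding d_def S_def by (rule mat_power_diff_component[OF L M ij agree])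
      ultimately have sums: "(\<lambda>k. d * (S k / fact k)) sums 0"
        by simp
      have "d = 0"
      proof (rule ccontr)
        assume "d \<noteq> 0"
        then have "(\<lambda>k. S k / fact k) sums 0"
          using sums_mult[OF sums, of "1 / d"] by simp
        then show False
          using exp_divided_difference_nonzero unfolding S_def by blast
      qed
      then show ?thesis by (simp add: d_def)
    qed
  qed
  moreover have "L $ i $ j = M $ i $ j" if "j < i" for i j
    using L M that by (simp add: upper_triangular_def)
  ultimately show ?thesis
    by (auto simp: vec_eq_iff) (metis not_le)
qed

text \<open>Injectivity lets a logarithm be computed by exhibiting one upper triangular
  preimage.\<close>

lemma ut_log_mat_exp:
  assumes "upper_triangular L"
  shows "ut_log (mat_exp L) = L"
  unfolding ut_log_def using assms
  by (intro the_equality) (auto intro: mat_exp_inj_on_upper_triangular)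

section \<open>Inverses and left translation\<close>

lemma matrix_inv_left:
  assumes "invertible A"
  shows "matrix_inv A ** A = mat 1"
  using someI_ex[OF assms[unfolded invertible_def]] by (simp add: matrix_inv_def)

text \<open>With \<open>Q\<close> the inverse of \<open>P\<close>, a common left factor
  \<open>X\<close> drops out; this removes the initial point from the iteration.\<close>

lemma matrix_inv_mult_cancel:
  fixes X P Q B :: "real ^ 'n ^ 'n"
  assumes X: "invertible X" and PQ: "P ** Q = mat 1"
  shows "matrix_inv (X ** P) ** (X ** B) = Q ** B"
proof -
  have QP: "Q ** P = mat 1"
    using PQ by (simp add: matrix_left_right_inverse)
  have "invertible (X ** P)"
    using X PQ QP by (intro invertible_mult) (auto simp: invertible_def)
  then have "matrix_inv (X ** P) ** X ** P = mat 1"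
    by (metis matrix_inv_left matrix_mul_assoc)
  then have "matrix_inv (X ** P) ** X = Q"
    by (metis PQ matrix_mul_assoc matrix_mul_lid matrix_mul_rid)
  then show ?thesis
    by (simp add: matrix_mul_assoc)
qed

section \<open>The affine group of the line inside the triangular group\<close>

text \<open>One family serves both levels: as it stands it is the Lie algebra, and after adding
  \<open>mat 1\<close> it gives the group elements. In the group, \<open>s\<close> is therefore the
  deviation of the diagonal entry from 1.\<close>

definition aff :: "'n \<Rightarrow> 'n \<Rightarrow> real \<Rightarrow> real \<Rightarrow> real ^ 'n ^ 'n" where
  "aff a b s v = (\<chi> i j. if i = a then if j = a then s else if j = b then v else 0 else 0)"

lemma aff_add: "aff a b s v + aff a b s' v' = aff a b (s + s') (v + v')"
  by (auto simp: aff_def vec_eq_iff)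

lemma aff_scaleR: "t *\<^sub>R aff a b s v = aff a b (t * s) (t * v)"
  by (auto simp: aff_def vec_eq_iff)

lemma aff_zero: "aff a b 0 0 = 0"
  by (auto simp: aff_def vec_eq_iff)

lemma aff_sum: "(\<Sum>i\<in>I. aff a b (s i) (v i)) = aff a b (sum s I) (sum v I)"
  by (induction I rule: infinite_finite_induct) (auto simp: aff_zero aff_add)

lemma mult_aff_component:
  assumes "a \<noteq> b"
  shows "(A ** aff a b s v) $ i $ j = (if j = a then A $ i $ a * s else if j = b then A $ i $ a * v else 0)"
proof -
  have "(A ** aff a b s v) $ i $ j = (\<Sum>k\<in>UNIV. if k = a then A $ i $ a * aff a b s v $ a $ j else 0)"
    unfolding matrix_mult_component by (intro sum.cong) (auto simp: aff_def)
  then show ?thesis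
    using assms by (simp add: aff_def)
qed

lemma aff_mult:
  assumes "a \<noteq> b"
  shows "aff a b s v ** aff a b s' v' = aff a b (s * s') (s * v')"
  by (simp add: vec_eq_iff mult_aff_component[OF assms]) (simp add: aff_def)

lemma matrix_add_rdistrib: "(A + B) ** C = A ** C + B ** C"
  by (simp add: vec_eq_iff matrix_mult_component distrib_right sum.distrib)

text \<open>This is the composition of the affine maps sending \<open>x\<close> to
  \<open>(1 + s) * x + v\<close> and to \<open>(1 + s') * x + v'\<close>, the primed one applied
  first.\<close>

lemma id_aff_mult:
  assumes "a \<noteq> b"
  shows "(mat 1 + aff a b s v) ** (mat 1 + aff a b s' v') = mat 1 + aff a b (s + s' + s * s') (v + v' + s * v')"
proof -
  have "(mat 1 + aff a b s v) ** (mat 1 + aff a b s' v')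
      = mat 1 + (aff a b s v + (aff a b s' v' + aff a b s v ** aff a b s' v'))"
    by (simp add: matrix_add_ldistrib matrix_add_rdistrib add_ac)
  then show ?thesis
    by (simp add: aff_mult[OF assms] aff_add add_ac)
qed

lemma upper_triangular_aff: "a < b \<Longrightarrow> upper_triangular (aff a b s v)"
  by (auto simp: upper_triangular_def aff_def)

lemma id_aff_in_UT: "a < b \<Longrightarrow> s > -1 \<Longrightarrow> mat 1 + aff a b s v \<in> UT"
  by (auto simp: UT_def upper_triangular_def aff_def mat_def)

section \<open>Closed forms of exponential and logarithm on the affine copy\<close>

text \<open>The value at 0 is the continuous extension, so the power series below holds for all real
  \<open>u\<close>.\<close>

definition exp_quot :: "real \<Rightarrow> real" where
  "exp_quot u = (if u = 0 then 1 else (exp u - 1) / u)"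

lemma exp_quot_pos: "exp_quot u > 0"
  by (cases u "0::real" rule: linorder_cases) (auto simp: exp_quot_def divide_neg_neg)

text \<open>Since \<open>exp_quot (- t) = (1 - exp (- t)) / t\<close>, the numerator is below 1.
  This is the unbounded growth that defeats every step size.\<close>

lemma inverse_exp_quot_ge: "1 / exp_quot (- t) \<ge> t" if "t > 0"
proof -
  have "exp_quot (- t) \<le> 1 / t"
    using that by (simp add: exp_quot_def field_simps)
  then show ?thesis
    using exp_quot_pos[of "- t"] that by (simp add: field_simps)
qed

lemma exp_quot_sums: "(\<lambda>k. u ^ k / fact (Suc k)) sums exp_quot u"
proof (cases "u = 0")
  case True
  then show ?thesis
    using powser_sums_zero[of "\<lambda>k. 1 / fact (Suc k) :: real"]
    by (simp add: exp_quot_def del: fact_Suc)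
next
  case False
  have "(\<lambda>k. u ^ k /\<^sub>R fact k) sums exp u"
    by (rule exp_converges)
  then have "(\<lambda>k. u ^ Suc k /\<^sub>R fact (Suc k)) sums (exp u - 1)"
    by (subst sums_Suc_iff) simp
  from sums_mult[OF this, of "1 / u"] show ?thesis
    using False by (simp add: exp_quot_def field_simps)
qed

lemma mat_power_aff:
  assumes "a \<noteq> b"
  shows "mat_power (aff a b u v) (Suc k) = u ^ k *\<^sub>R aff a b u v"
proof (induction k)
  case (Suc k)
  have "mat_power (aff a b u v) (Suc (Suc k)) = aff a b u v ** mat_power (aff a b u v) (Suc k)"
    by (rule mat_power_Suc)
  then show ?case
    by (simp add: Suc aff_scaleR aff_mult[OF assms] algebra_simps del: mat_power_Suc)
qed simp

text \<open>The matrix \<open>R = aff a b u v\<close> satisfies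
  \<open>R ** R = u *\<^sub>R R\<close>, so the series beyond its constant term collapses to a
  scalar multiple of \<open>R\<close>.\<close>

lemma mat_exp_aff:
  assumes "a \<noteq> b"
  shows "mat_exp (aff a b u v) = mat 1 + aff a b (exp u - 1) (exp_quot u * v)"
proof -
  let ?R = "aff a b u v"
  have "mat_exp ?R $ i $ j = (mat 1 + exp_quot u *\<^sub>R ?R) $ i $ j" for i j
  proof -
    have "(\<lambda>k. (u ^ k / fact (Suc k)) * ?R $ i $ j) sums (exp_quot u * ?R $ i $ j)"
      by (intro sums_mult2 exp_quot_sums)
    then have "(\<lambda>k. mat_power ?R (Suc k) $ i $ j / fact (Suc k)) sums (exp_quot u * ?R $ i $ j)"
      unfolding mat_power_aff[OF assms] by simp
    then have "(\<lambda>k. mat_power ?R k $ i $ j / fact k) sums (exp_quot u * ?R $ i $ j + mat 1 $ i $ j)"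
      by (subst (asm) sums_Suc_iff) simp
    then show ?thesis
      using mat_exp_component_sums[of ?R i j] by (simp add: sums_unique2 add.commute)
  qed
  then have "mat_exp ?R = mat 1 + exp_quot u *\<^sub>R ?R"
    by (simp add: vec_eq_iff)
  moreover have "exp_quot u * u = exp u - 1"
    by (simp add: exp_quot_def)
  ultimately show ?thesis
    by (simp add: aff_scaleR)
qed

lemma ut_log_id_aff:
  assumes "a < b"
  shows "ut_log (mat 1 + aff a b (exp u - 1) v) = aff a b u (v / exp_quot u)"
proof -
  have "mat 1 + aff a b (exp u - 1) v = mat_exp (aff a b u (v / exp_quot u))"
    using assms exp_quot_pos[of u] by (simp add: mat_exp_aff)
  then show ?thesis
    using ut_log_mat_exp upper_triangular_aff[OF assms] by metis
qed

section \<open>Reduction to a scalar recurrence and its divergence\<close>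

text \<open>The hypothesis on \<open>u\<close> makes the averaged logarithm vanish at
  \<open>(a, a)\<close>, so the diagonal does not move. On the unit-diagonal matrices
  \<open>mat 1 + aff a b 0 v\<close> the logarithm just drops \<open>mat 1\<close>, and comparing
  \<open>(a, b)\<close> entries leaves the recurrence for \<open>y\<close>.\<close>

lemma iteration_id_aff:
  fixes X\<^sub>0 :: "real ^ 'n::{finite,linorder} ^ 'n::_"
  assumes ab: "a < b" and X0: "X\<^sub>0 \<in> UT" and u: "(\<Sum>i=1..m. w i * u i) = 0"
    and y0: "y 0 = 0"
    and y: "\<And>k. y (Suc k) = y k + (1 / c) * (\<Sum>i=1..m. w i * ((q i - y k) / exp_quot (u i)))"
  shows "projection_mean_iteration m w c (\<lambda>i. X\<^sub>0 ** (mat 1 + aff a b (exp (u i) - 1) (q i)))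
    X\<^sub>0 (\<lambda>k. X\<^sub>0 ** (mat 1 + aff a b 0 (y k)))"
proof -
  have ne: "a \<noteq> b" using ab by simp
  have left: "matrix_inv (X\<^sub>0 ** (mat 1 + aff a b 0 z)) ** (X\<^sub>0 ** (mat 1 + aff a b s v))
      = mat 1 + aff a b s (v - z)" for z s v
    by (subst matrix_inv_mult_cancel[OF invertible_UT[OF X0], where Q = "mat 1 + aff a b 0 (- z)"])
      (simp_all add: id_aff_mult[OF ne] aff_zero)
  have log0: "ut_log (mat 1 + aff a b 0 v) = aff a b 0 v" for v
    using ut_log_id_aff[OF ab, of 0 v] by (simp add: exp_quot_def)
  show ?thesis
    unfolding projection_mean_iteration_def left log0 ut_log_id_aff[OF ab] aff_scaleR aff_sum
    using X0 by (simp add: y0 y u[unfolded One_nat_def] aff_zero UT_mult id_aff_in_UT[OF ab])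
qed

text \<open>The increments form a geometric sequence starting at \<open>\<mu>\<close> with ratio
  \<open>1 - \<kappa>\<close>, at most -1, so they cannot tend to 0.\<close>

lemma not_convergent_affine_recurrence:
  fixes y :: "nat \<Rightarrow> real"
  assumes "\<And>k. y (Suc k) = y k + (\<mu> - \<kappa> * y k)" and "y 0 = 0" and "\<kappa> \<ge> 2" and "\<mu> \<noteq> 0"
  shows "\<not> convergent y"
proof
  assume "convergent y"
  then obtain l where "y \<longlonglongrightarrow> l"
    by (auto simp: convergent_def)
  then have "(\<lambda>k. y (Suc k) - y k) \<longlonglongrightarrow> l - l"
    by (intro tendsto_diff LIMSEQ_Suc)
  then have lim: "(\<lambda>k. \<bar>y (Suc k) - y k\<bar>) \<longlonglongrightarrow> 0"
    by (simp add: tendsto_rabs_zero)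
  have "y (Suc k) - y k = (1 - \<kappa>) ^ k * \<mu>" for k
  proof (induction k)
    case 0
    show ?case by (simp add: assms(1,2))
  next
    case (Suc k)
    have "y (Suc (Suc k)) - y (Suc k) = (1 - \<kappa>) * (y (Suc k) - y k)"
      using assms(1)[of k] assms(1)[of "Suc k"] by (simp add: algebra_simps)
    then show ?case by (simp add: Suc)
  qed
  moreover have "\<bar>(1 - \<kappa>) ^ k\<bar> \<ge> 1" for k
    using assms(3) by (simp add: power_abs one_le_power)
  ultimately have "\<bar>y (Suc k) - y k\<bar> \<ge> \<bar>\<mu>\<bar>" for k
    by (simp add: abs_mult mult_le_cancel_right1)
  then have "\<bar>\<mu>\<bar> \<le> 0"
    by (intro LIMSEQ_le_const[OF lim]) auto
  with assms(4) show False by simp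
qed

section \<open>Data that defeat a given step size\<close>

theorem theorem4p3:
  fixes m :: nat and w :: "nat \<Rightarrow> real"
    and X\<^sub>0 :: "real ^ 'n::{finite,linorder} ^ 'n::_"
  assumes "CARD('n) \<ge> 2" and "m \<ge> 2"
    and "probability_vector m w"
    and "card {i \<in> {1..m}. w i > 0} \<ge> 2"
    and "X\<^sub>0 \<in> UT"
  shows "\<not> (\<exists>c>0. \<forall>A :: nat \<Rightarrow> real ^ 'n::_ ^ 'n::_. (\<forall>i\<in>{1..m}. A i \<in> UT) \<longrightarrow>
           (\<forall>X. projection_mean_iteration m w c A X\<^sub>0 X \<longrightarrow> convergent X))"
proof
  assume "\<exists>c>0. \<forall>A :: nat \<Rightarrow> real ^ 'n::_ ^ 'n::_. (\<forall>i\<in>{1..m}. A i \<in> UT) \<longrightarrow>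
           (\<forall>X. projection_mean_iteration m w c A X\<^sub>0 X \<longrightarrow> convergent X)"
  then obtain c where c: "c > 0"
    and conv: "\<And>(A :: nat \<Rightarrow> real ^ 'n::_ ^ 'n::_) X. (\<forall>i\<in>{1..m}. A i \<in> UT) \<Longrightarrow>
        projection_mean_iteration m w c A X\<^sub>0 X \<Longrightarrow> convergent X"
    by blast
  obtain S :: "'n set" where "card S = 2"
    using obtain_subset_with_card_n[OF assms(1)] by blast
  then obtain a' b' :: 'n where "a' \<noteq> b'"
    by (auto simp: card_2_iff)
  then obtain a b :: 'n where ab: "a < b"
    by (metis neq_iff)
  obtain p q where pq: "p \<in> {1..m}" "q \<in> {1..m}" "p \<noteq> q" "w p > 0" "w q > 0"
  proof -
    obtain S where "S \<subseteq> {i \<in> {1..m}. w i > 0}" "card S = 2"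
      using obtain_subset_with_card_n[OF assms(4)] by blast
    then show ?thesis
      using that by (auto simp: card_2_iff)
  qed
  \<comment> \<open>Chosen so that \<open>w p * T / c = 2\<close>: the index \<open>p\<close> alone
    then pushes \<open>\<kappa>\<close> to at least 2.\<close>
  define T where "T = 2 * c / w p"
  have T: "T > 0" using c pq by (simp add: T_def)
  \<comment> \<open>The value at \<open>q\<close> balances the one at \<open>p\<close>, making the
    weighted mean zero; this is where the second positive weight enters.\<close>
  define u where "u = (\<lambda>i. if i = p then - T else if i = q then T * w p / w q else 0)"
  \<comment> \<open>A nonzero offset at \<open>p\<close> makes \<open>\<mu>\<close> nonzero, so the
    start 0 is not the fixed point of the recurrence.\<close>
  define v where "v = (\<lambda>i. if i = p then 1 else 0 :: real)"
  define \<kappa> where "\<kappa> = (1 / c) * (\<Sum>i=1..m. w i / exp_quot (u i))"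
  define \<mu> where "\<mu> = (1 / c) * (w p / exp_quot (u p))"
  define y where "y = rec_nat 0 (\<lambda>_ z. z + (\<mu> - \<kappa> * z))"
  have y: "y 0 = 0" "y (Suc k) = y k + (\<mu> - \<kappa> * y k)" for k
    by (simp_all add: y_def)
  have "(\<Sum>i=1..m. w i * u i) = (\<Sum>i=1..m. (if i = p then - w p * T else 0) + (if i = q then T * w p else 0))"
    using pq by (intro sum.cong) (auto simp: u_def)
  also have "\<dots> = 0"
    using pq by (simp add: sum.distrib)
  finally have u: "(\<Sum>i=1..m. w i * u i) = 0" .
  have "(\<Sum>i=1..m. w i * ((v i - z) / exp_quot (u i)))
      = (\<Sum>i=1..m. (if i = p then w p / exp_quot (u p) else 0) - z * (w i / exp_quot (u i)))" for z
    by (intro sum.cong) (auto simp: v_def algebra_simps diff_divide_distrib)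
  then have mean: "(\<Sum>i=1..m. w i * ((v i - z) / exp_quot (u i)))
      = w p / exp_quot (u p) - z * (\<Sum>i=1..m. w i / exp_quot (u i))" for z
    using pq by (simp add: sum_subtractf sum_distrib_left)
  have rec: "y (Suc k) = y k + (1 / c) * (\<Sum>i=1..m. w i * ((v i - y k) / exp_quot (u i)))" for k
    unfolding mean y by (simp add: \<kappa>_def \<mu>_def algebra_simps diff_divide_distrib)
  \<comment> \<open>All terms of the sum in \<open>\<kappa>\<close> are nonnegative, so it is
    bounded below by its term at \<open>p\<close>.\<close>
  have "w p * T \<le> w p * (1 / exp_quot (u p))"
    using pq inverse_exp_quot_ge[OF T] by (intro mult_left_mono) (auto simp: u_def)
  also have "\<dots> = (\<Sum>i\<in>{p}. w i / exp_quot (u i))"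
    by simp
  also have "\<dots> \<le> (\<Sum>i=1..m. w i / exp_quot (u i))"
    using pq assms(3) exp_quot_pos
    by (intro sum_mono2) (auto simp: probability_vector_def intro!: divide_nonneg_pos)
  finally have "\<kappa> \<ge> 2"
    using c pq by (simp add: \<kappa>_def T_def field_simps)
  moreover have "\<mu> \<noteq> 0"
    using c pq exp_quot_pos[of "u p"] by (simp add: \<mu>_def)
  ultimately have y_div: "\<not> convergent y"
    using not_convergent_affine_recurrence y by blast
  define X where "X = (\<lambda>k. X\<^sub>0 ** (mat 1 + aff a b 0 (y k)))"
  have "convergent X"
    unfolding X_def
    by (rule conv[OF _ iteration_id_aff[OF ab assms(5) u y(1) rec]])
      (auto intro!: UT_mult assms(5) id_aff_in_UT ab)
  then obtain Z where Z: "X \<longlonglongrightarrow> Z"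
    by (auto simp: convergent_def)
  have X0a: "X\<^sub>0 $ a $ a \<noteq> 0"
    using assms(5) by (auto simp: UT_def dest!: spec[of _ a])
  \<comment> \<open>This entry is affine in \<open>y k\<close> with nonzero slope, so convergence of
    \<open>X\<close> would carry over to \<open>y\<close>.\<close>
  have "X k $ a $ b = X\<^sub>0 $ a $ b + X\<^sub>0 $ a $ a * y k" for k
    using ab by (simp add: X_def matrix_add_ldistrib mult_aff_component)
  then have "y = (\<lambda>k. (X k $ a $ b - X\<^sub>0 $ a $ b) / X\<^sub>0 $ a $ a)"
    using X0a by simp
  moreover have "(\<lambda>k. (X k $ a $ b - X\<^sub>0 $ a $ b) / X\<^sub>0 $ a $ a)
      \<longlonglongrightarrow> (Z $ a $ b - X\<^sub>0 $ a $ b) / X\<^sub>0 $ a $ a"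
    by (intro tendsto_intros Z X0a)
  ultimately show False
    using y_div by (auto simp: convergent_def)
qed

end
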